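(* For a positive integer $n$, let ${\rm ACG}(n)$ denote the set of all circulant graphs of order $n$, and let ${\rm Small}(n)$ denote the set of those $\Gamma\in{\rm ACG}(n)$ with ${\rm Aut}(\Gamma)=\langle\rho,\iota\rangle$, where $\rho(i)=i+1$ and $\iota(i)=-i$ (mod $n$). Then $$\lim_{n\to\infty}\frac{\vert {\rm Small}(n)\vert}{\vert{\rm ACG}(n)\vert}=1.$$
   Context: A circulant digraph of order $n$ is the digraph $\Gamma(\mathbb{Z}_n,S)$ with vertex set $\mathbb{Z}_n$ and arc set $\{(u,v): u-v\in S\}$, where the connection set $S$ satisfies $S\subseteq\mathbb{Z}_n\setminus\{0\}$; it is a circulant graph if $S=-S$. Circulant (di)graphs of order $n$ are counted as labelled objects, i.e. distinct connection sets give distinct (di)graphs. The group $\langle\rho,\iota\rangle$ is dihedral of order $2n$ (for $n\ge 3$) and is always contained in the automorphism group of a circulant graph. *)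

theory Defs
  imports
    "HOL-Algebra.Bij"
    "HOL-Algebra.Generated_Groups"
    "Graph_Theory.Pair_Digraph"
    Complex_Main
begin

text \<open>
  Residues modulo \<open>n\<close> are represented by the integers in \<open>{0..<int n}\<close>.
\<close>

abbreviation residues_mod :: "nat \<Rightarrow> int set"
  where "residues_mod n \<equiv> {0..<int n}"

definition circulant_digraph :: "nat \<Rightarrow> int set \<Rightarrow> int pair_pre_digraph"
  where "circulant_digraph n S =
    \<lparr>pverts = residues_mod n,
     parcs = {(u, v). u \<in> residues_mod n \<and> v \<in> residues_mod n \<and> (u - v) mod int n \<in> S}\<rparr>"

definition ACG :: "nat \<Rightarrow> int pair_pre_digraph set"
  where "ACG n = {circulant_digraph n S | S.
    S \<subseteq> residues_mod n - {0} \<and> (\<lambda>s. (- s) mod int n) ` S = S}"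

text \<open>
  The elements of \<open>Bij V\<close> are the permutations of \<open>V\<close>, made undefined outside \<open>V\<close>,
  so that automorphisms with the same action on vertices are equal.
\<close>

definition graph_Aut :: "'a pair_pre_digraph \<Rightarrow> ('a \<Rightarrow> 'a) set"
  where "graph_Aut \<Gamma> = {f \<in> Bij (pverts \<Gamma>).
    \<forall>u\<in>pverts \<Gamma>. \<forall>v\<in>pverts \<Gamma>. (f u, f v) \<in> parcs \<Gamma> \<longleftrightarrow> (u, v) \<in> parcs \<Gamma>}"

definition rot :: "nat \<Rightarrow> int \<Rightarrow> int"
  where "rot n = (\<lambda>i\<in>residues_mod n. (i + 1) mod int n)"

definition refl_map :: "nat \<Rightarrow> int \<Rightarrow> int"
  where "refl_map n = (\<lambda>i\<in>residues_mod n. (- i) mod int n)"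

definition Small :: "nat \<Rightarrow> int pair_pre_digraph set"
  where "Small n = {\<Gamma> \<in> ACG n.
    graph_Aut \<Gamma> = generate (BijGroup (residues_mod n)) {rot n, refl_map n}}"

lemma subgroup_graph_Aut: "subgroup (graph_Aut \<Gamma>) (BijGroup (pverts \<Gamma>))"
proof (rule group.subgroupI[OF group_BijGroup])
  show "graph_Aut \<Gamma> \<subseteq> carrier (BijGroup (pverts \<Gamma>))"
    by (auto simp: graph_Aut_def BijGroup_def)
  have "(\<lambda>x\<in>pverts \<Gamma>. x) \<in> graph_Aut \<Gamma>"
    by (auto simp: graph_Aut_def id_Bij)
  then show "graph_Aut \<Gamma> \<noteq> {}" by blast
next
  fix f assume f: "f \<in> graph_Aut \<Gamma>"
  then have fB: "f \<in> Bij (pverts \<Gamma>)" by (simp add: graph_Aut_def)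
  then have bij: "bij_betw f (pverts \<Gamma>) (pverts \<Gamma>)" by (simp add: Bij_def)
  have mem: "inv_into (pverts \<Gamma>) f x \<in> pverts \<Gamma>" and
    inv: "f (inv_into (pverts \<Gamma>) f x) = x" if "x \<in> pverts \<Gamma>" for x
    using that bij by (auto simp: bij_betw_def inv_into_into f_inv_into_f)
  have arc: "(f u, f v) \<in> parcs \<Gamma> \<longleftrightarrow> (u, v) \<in> parcs \<Gamma>"
    if "u \<in> pverts \<Gamma>" "v \<in> pverts \<Gamma>" for u v
    using f that by (simp add: graph_Aut_def)
  have "(inv_into (pverts \<Gamma>) f u, inv_into (pverts \<Gamma>) f v) \<in> parcs \<Gamma> \<longleftrightarrow> (u, v) \<in> parcs \<Gamma>"
    if "u \<in> pverts \<Gamma>" "v \<in> pverts \<Gamma>" for u v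
    using arc[OF mem[OF that(1)] mem[OF that(2)]] inv[OF that(1)] inv[OF that(2)] by simp
  then show "inv\<^bsub>BijGroup (pverts \<Gamma>)\<^esub> f \<in> graph_Aut \<Gamma>"
    using restrict_inv_into_Bij[OF fB] by (simp add: inv_BijGroup[OF fB] graph_Aut_def)
next
  fix f g assume "f \<in> graph_Aut \<Gamma>" "g \<in> graph_Aut \<Gamma>"
  then show "f \<otimes>\<^bsub>BijGroup (pverts \<Gamma>)\<^esub> g \<in> graph_Aut \<Gamma>"
    using Bij_imp_funcset[of g "pverts \<Gamma>"]
    by (auto simp: graph_Aut_def BijGroup_def compose_Bij compose_eq Pi_iff)
qed

lemma rot_refl_in_Bij: "rot n \<in> Bij (residues_mod n)" "refl_map n \<in> Bij (residues_mod n)"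
proof -
  have "bij_betw (rot n) (residues_mod n) (residues_mod n)"
    by (rule bij_betw_byWitness[where f' = "\<lambda>i. (i - 1) mod int n"])
       (auto simp: rot_def mod_diff_left_eq mod_add_left_eq)
  then show "rot n \<in> Bij (residues_mod n)" by (simp add: Bij_def rot_def)
  have "bij_betw (refl_map n) (residues_mod n) (residues_mod n)"
    by (rule bij_betw_byWitness[where f' = "\<lambda>i. (- i) mod int n"])
       (auto simp: refl_map_def mod_minus_eq)
  then show "refl_map n \<in> Bij (residues_mod n)" by (simp add: Bij_def refl_map_def)
qed

text \<open>
  Distinct connection sets give distinct digraphs, so counting elements of
  \<open>ACG n\<close> counts labelled graphs.
\<close>

lemma inj_on_circulant_digraph: "inj_on (circulant_digraph n) (Pow (residues_mod n - {0}))"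
proof (rule inj_onI)
  fix S T
  assume S: "S \<in> Pow (residues_mod n - {0})" and T: "T \<in> Pow (residues_mod n - {0})"
    and eq: "circulant_digraph n S = circulant_digraph n T"
  have conn: "A = {x. (x, 0) \<in> parcs (circulant_digraph n A)}"
    if "A \<in> Pow (residues_mod n - {0})" for A
    using that by (force simp: circulant_digraph_def)
  show "S = T"
    by (subst conn[OF S], subst conn[OF T], simp only: eq)
qed

lemma pair_graph_ACG:
  assumes "\<Gamma> \<in> ACG n" shows "pair_graph \<Gamma>"
proof -
  obtain S where S: "S \<subseteq> residues_mod n - {0}" "(\<lambda>s. (- s) mod int n) ` S = S"
    and \<Gamma>: "\<Gamma> = circulant_digraph n S"
    using assms by (auto simp: ACG_def)
  have sym: "(v - u) mod int n \<in> S" if "(u - v) mod int n \<in> S" for u v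
  proof -
    have "(- ((u - v) mod int n)) mod int n \<in> S" using S(2) that by blast
    then show ?thesis by (simp add: mod_minus_eq)
  qed
  have "finite (parcs \<Gamma>)"
    by (rule finite_subset[of _ "residues_mod n \<times> residues_mod n"])
       (auto simp: \<Gamma> circulant_digraph_def)
  then show ?thesis
    using S(1) by unfold_locales
      (auto simp: \<Gamma> circulant_digraph_def symmetric_def arcs_ends_conv sym_def sym)
qed

lemma finite_ACG: "finite (ACG n)"
  by (rule finite_subset[of _ "circulant_digraph n ` Pow (residues_mod n)"])
     (auto simp: ACG_def)

lemma ACG_nonempty: "ACG n \<noteq> {}"
  by (auto simp: ACG_def)

end

theory Submission
  imports
    Defs
    "HOL-Computational_Algebra.Polynomial"
    "HOL-Number_Theory.Number_Theory"
    "HOL-Real_Asymp.Real_Asymp"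
begin

text \<open>
  By Schur's theorem on multipliers, an automorphism \<open>\<phi>\<close> of the circulant graph with connection
  set \<open>S\<close> is also an automorphism of the one with connection set \<open>m S\<close>, for every unit \<open>m\<close>
  modulo \<open>n\<close>. Hence, if \<open>y = \<phi> (u + 1) - \<phi> u\<close>, then \<open>m \<in> S\<close> if and only if \<open>m y \<in> S\<close>, for
  all units \<open>m\<close>. For a fixed \<open>y\<close> other than \<open>1\<close> and \<open>-1\<close>, at most a proportion of
  \<open>2 powr (- t / 6)\<close>, \<open>t\<close> the totient of \<open>n\<close>, of the inverse-closed sets \<open>S\<close> has this property; since
  \<open>2 t\<^sup>2 \<ge> n\<close>, summing over the fewer than \<open>n\<close> values of \<open>y\<close> still gives a null sequence. For all
  other \<open>S\<close>, every automorphism satisfies \<open>\<phi> (u + 1) = \<phi> u + 1\<close> or \<open>\<phi> (u + 1) = \<phi> u - 1\<close> for all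
  \<open>u\<close>, so it is an automorphism of the \<open>n\<close>-cycle and therefore dihedral.
\<close>

section \<open>Schur's theorem on multipliers\<close>

text \<open>The inner binomial coefficients are divisible by \<open>p\<close>. The ring is general
  because this Frobenius congruence is applied to integer polynomials.\<close>

lemma prime_dvd_power_add_diff:
  fixes x y :: "'a :: comm_ring_1"
  assumes "prime p"
  shows "of_nat p dvd (x + y) ^ p - (x ^ p + y ^ p)"
proof -
  have "(x + y) ^ p = (\<Sum>k\<le>p. of_nat (p choose k) * x ^ k * y ^ (p - k))"
    by (rule binomial_ring)
  also have "{..p} = insert 0 (insert p {0<..<p})"
    using prime_gt_0_nat[OF assms] by auto
  also have "(\<Sum>k\<in>\<dots>. of_nat (p choose k) * x ^ k * y ^ (p - k)) =
      x ^ p + y ^ p + (\<Sum>k\<in>{0<..<p}. of_nat (p choose k) * x ^ k * y ^ (p - k))"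
    using prime_gt_0_nat[OF assms] by (subst sum.insert) (auto simp: ac_simps)
  finally have "(x + y) ^ p - (x ^ p + y ^ p) =
      (\<Sum>k\<in>{0<..<p}. of_nat (p choose k) * x ^ k * y ^ (p - k))" by simp
  moreover have "of_nat p dvd (of_nat (p choose k) * x ^ k * y ^ (p - k) :: 'a)"
    if "k \<in> {0<..<p}" for k
  proof -
    have "p dvd (p choose k)"
      by (rule dvd_choose_prime) (use that assms in auto)
    then show ?thesis by (auto simp: dvd_def mult.assoc)
  qed
  ultimately show ?thesis by (auto intro!: dvd_sum)
qed

lemma prime_dvd_power_sum_diff:
  fixes f :: "'b \<Rightarrow> 'a :: comm_ring_1"
  assumes "prime p"
  shows "of_nat p dvd (\<Sum>i\<in>A. f i) ^ p - (\<Sum>i\<in>A. f i ^ p)"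
proof (induction A rule: infinite_finite_induct)
  case (insert a A)
  have "of_nat p dvd ((f a + sum f A) ^ p - (f a ^ p + sum f A ^ p)) + (sum f A ^ p - (\<Sum>i\<in>A. f i ^ p))"
    by (intro dvd_add prime_dvd_power_add_diff assms insert.IH)
  then show ?case using insert.hyps by (simp add: algebra_simps)
qed (use prime_gt_0_nat[OF assms] in \<open>auto simp: power_0_left\<close>)

text \<open>
  The indeterminate acts on functions as the shift \<open>u \<mapsto> u - 1\<close>, so that the polynomial with
  exponent set \<open>S\<close> acts on periodic functions as the adjacency operator of the circulant graph.
\<close>

definition shift_act :: "int poly \<Rightarrow> (int \<Rightarrow> int) \<Rightarrow> int \<Rightarrow> int"
  where "shift_act P h u = (\<Sum>i\<le>degree P. Polynomial.coeff P i * h (u - int i))"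

lemma shift_act_eq:
  assumes "degree P \<le> N"
  shows "shift_act P h u = (\<Sum>i\<le>N. Polynomial.coeff P i * h (u - int i))"
  unfolding shift_act_def using assms
  by (intro sum.mono_neutral_left) (auto simp: coeff_eq_0)

lemma shift_act_0 [simp]: "shift_act 0 h u = 0"
  by (simp add: shift_act_def)

lemma shift_act_add: "shift_act (P + Q) h u = shift_act P h u + shift_act Q h u"
proof -
  let ?N = "max (degree P) (degree Q)"
  have "degree (P + Q) \<le> ?N" by (rule degree_add_le_max)
  then show ?thesis
    by (simp add: shift_act_eq[where N = ?N] sum.distrib[symmetric] algebra_simps)
qed

lemma shift_act_smult: "shift_act (Polynomial.smult c P) h u = c * shift_act P h u"
  by (subst shift_act_eq[where N = "degree P"])
     (auto simp: degree_smult_le shift_act_def sum_distrib_left mult.assoc)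

lemma shift_act_pCons: "shift_act (pCons a P) h u = a * h u + shift_act P h (u - 1)"
  by (subst shift_act_eq[where N = "Suc (degree P)"])
     (auto simp: degree_pCons_le shift_act_def sum.atMost_Suc_shift algebra_simps simp del: sum.atMost_Suc)

text \<open>Multiplication of polynomials becomes composition of operators, so a power of a
  polynomial acts as an iterate.\<close>

lemma shift_act_mult: "shift_act (P * Q) h u = shift_act P (shift_act Q h) u"
  by (induction P arbitrary: u)
     (simp_all add: shift_act_add shift_act_smult shift_act_pCons)

lemma shift_act_monom: "shift_act (Polynomial.monom c k) h u = c * h (u - int k)"
  by (subst shift_act_eq[where N = k]) (auto simp: degree_monom_le if_distrib if_distribR sum.delta cong: if_cong)

lemma shift_act_sum: "shift_act (\<Sum>i\<in>A. P i) h u = (\<Sum>i\<in>A. shift_act (P i) h u)"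
  by (induction A rule: infinite_finite_induct) (simp_all add: shift_act_add)

lemma shift_act_1: "shift_act 1 h u = h u"
  by (simp add: one_pCons shift_act_pCons)

section \<open>Periodic functions and dilated connection sets\<close>

definition periodic :: "nat \<Rightarrow> (int \<Rightarrow> int) \<Rightarrow> bool"
  where "periodic n h \<longleftrightarrow> (\<forall>u v. [u = v] (mod int n) \<longrightarrow> h u = h v)"

lemma periodicD: "periodic n h \<Longrightarrow> [u = v] (mod int n) \<Longrightarrow> h u = h v"
  by (simp add: periodic_def)

lemma periodic_shift_act:
  assumes "periodic n h"
  shows "periodic n (shift_act P h)"
  unfolding periodic_def
proof (intro allI impI)
  fix u v :: int assume "[u = v] (mod int n)"
  then have "h (u - int i) = h (v - int i)" for i
    by (intro periodicD[OF assms] cong_diff cong_refl)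
  then show "shift_act P h u = shift_act P h v" by (simp add: shift_act_def)
qed

text \<open>The arc condition for automorphisms, freed from the graph type so that it can be moved
  from one connection set to its dilates.\<close>

definition preserves :: "nat \<Rightarrow> (int \<Rightarrow> int) \<Rightarrow> int set \<Rightarrow> bool"
  where "preserves n \<phi> S \<longleftrightarrow> (\<forall>u\<in>residues_mod n. \<forall>v\<in>residues_mod n.
    (\<phi> u - \<phi> v) mod int n \<in> S \<longleftrightarrow> (u - v) mod int n \<in> S)"

definition dilate :: "nat \<Rightarrow> int \<Rightarrow> int set \<Rightarrow> int set"
  where "dilate n m S = (\<lambda>a. (m * a) mod int n) ` S"

text \<open>Substituting \<open>v = u - a\<close> gives a sum over the out-neighbours of
  \<open>u\<close>, which a permutation of the vertices can reindex.\<close>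

lemma sum_translates:
  assumes "n > 0" "S \<subseteq> residues_mod n" "periodic n h"
  shows "(\<Sum>a\<in>S. h (u - a)) = (\<Sum>v | v \<in> residues_mod n \<and> (u - v) mod int n \<in> S. h v)"
proof (rule sum.reindex_bij_witness[where i = "\<lambda>v. (u - v) mod int n" and j = "\<lambda>a. (u - a) mod int n"])
  fix a assume "a \<in> S"
  then have a: "a mod int n = a" using assms(2) by auto
  then show "(u - (u - a) mod int n) mod int n = a" by (simp add: mod_diff_right_eq)
  with \<open>a \<in> S\<close> show "(u - a) mod int n \<in> {v. v \<in> residues_mod n \<and> (u - v) mod int n \<in> S}"
    using assms(1) by simp
  show "h ((u - a) mod int n) = h (u - a)"
    by (rule periodicD[OF assms(3)]) (simp add: Cong.cong_def)
next
  fix v assume v: "v \<in> {v. v \<in> residues_mod n \<and> (u - v) mod int n \<in> S}"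
  then show "(u - (u - v) mod int n) mod int n = v" by (simp add: mod_diff_right_eq)
  show "(u - v) mod int n \<in> S" using v by simp
qed

section \<open>Permutations commuting with the adjacency operator\<close>

locale residue_perm =
  fixes n :: nat and \<phi> :: "int \<Rightarrow> int"
  assumes n_pos: "n > 0" and bij: "bij_betw \<phi> (residues_mod n) (residues_mod n)"
begin

text \<open>\<open>shift_act\<close> needs functions on all integers, hence the periodic extension
  of \<open>\<phi>\<close>.\<close>

definition ext :: "int \<Rightarrow> int"
  where "ext u = \<phi> (u mod int n)"

definition commutes :: "int poly \<Rightarrow> bool"
  where "commutes P \<longleftrightarrow> (\<forall>h. periodic n h \<longrightarrow> (\<forall>u. shift_act P (h \<circ> ext) u = shift_act P h (ext u)))"

lemma mod_in [simp]: "u mod int n \<in> residues_mod n"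
  using n_pos by simp

lemma ext_in: "ext u \<in> residues_mod n"
  using bij n_pos unfolding ext_def bij_betw_def by (auto simp del: atLeastLessThan_iff)

lemma ext_eq_iff: "ext u = ext v \<longleftrightarrow> [u = v] (mod int n)"
  unfolding ext_def Cong.cong_def by (rule inj_on_eq_iff[OF bij_betw_imp_inj_on[OF bij] mod_in mod_in])

lemma periodic_comp_ext: "periodic n (h \<circ> ext)"
  unfolding periodic_def comp_def using ext_eq_iff by metis

text \<open>\<open>shift_act Q h\<close> is again periodic, so the hypothesis on \<open>P\<close>
  applies to it.\<close>

lemma commutes_mult:
  assumes "commutes P" "commutes Q"
  shows "commutes (P * Q)"
  unfolding commutes_def
proof (intro allI impI)
  fix h u assume h: "periodic n h"
  have "shift_act Q (h \<circ> ext) = shift_act Q h \<circ> ext"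
    using assms(2) h by (auto simp: commutes_def)
  then show "shift_act (P * Q) (h \<circ> ext) u = shift_act (P * Q) h (ext u)"
    using assms(1) h by (simp add: commutes_def shift_act_mult periodic_shift_act)
qed

lemma commutes_power: "commutes P \<Longrightarrow> commutes (P ^ k)"
  by (induction k) (auto simp: commutes_mult, simp add: commutes_def shift_act_1)

text \<open>An automorphism carries the out-neighbours of \<open>u\<close> bijectively to those of
  its image, so summing over neighbours commutes with it.\<close>

lemma commutes_connection_poly:
  assumes S: "S \<subseteq> residues_mod n" and "preserves n \<phi> S"
  shows "commutes (\<Sum>a\<in>S. Polynomial.monom 1 (nat a))"
  unfolding commutes_def
proof (intro allI impI)
  fix h :: "int \<Rightarrow> int" and u assume h: "periodic n h"
  have act: "shift_act (\<Sum>a\<in>S. Polynomial.monom 1 (nat a)) g w = (\<Sum>a\<in>S. g (w - a))" for g w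
    unfolding shift_act_sum shift_act_monom using S by (intro sum.cong) auto
  have pres: "(ext u - \<phi> v) mod int n \<in> S \<longleftrightarrow> (u - v) mod int n \<in> S" if "v \<in> residues_mod n" for v
    using assms(2) that mod_in[of u] unfolding preserves_def ext_def
    by (metis mod_diff_left_eq)
  have image_filter: "\<phi> ` {v \<in> V. P (\<phi> v)} = {w \<in> \<phi> ` V. P w}" for V P by blast
  have "(\<Sum>a\<in>S. (h \<circ> ext) (u - a)) =
      (\<Sum>v | v \<in> residues_mod n \<and> (u - v) mod int n \<in> S. h (ext v))"
    by (subst sum_translates[OF n_pos S periodic_comp_ext]) simp
  also have "\<dots> = (\<Sum>v | v \<in> residues_mod n \<and> (u - v) mod int n \<in> S. h (\<phi> v))"
    by (intro sum.cong) (auto simp: ext_def)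
  also have "\<dots> = (\<Sum>v \<in> {v \<in> residues_mod n. (ext u - \<phi> v) mod int n \<in> S}. h (\<phi> v))"
    by (rule sum.cong) (auto simp: pres simp del: atLeastLessThan_iff)
  also have "\<dots> = (\<Sum>w \<in> \<phi> ` {v \<in> residues_mod n. (ext u - \<phi> v) mod int n \<in> S}. h w)"
    by (subst sum.reindex) (auto intro: inj_on_subset[OF bij_betw_imp_inj_on[OF bij]])
  also have "\<phi> ` {v \<in> residues_mod n. (ext u - \<phi> v) mod int n \<in> S} =
      {w \<in> residues_mod n. (ext u - w) mod int n \<in> S}"
    using image_filter[of "residues_mod n" "\<lambda>w. (ext u - w) mod int n \<in> S"]
    unfolding bij_betw_imp_surj_on[OF bij] .
  also have "(\<Sum>w\<in>\<dots>. h w) = (\<Sum>a\<in>S. h (ext u - a))"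
    by (rule sum_translates[OF n_pos S h, symmetric])
  finally show "shift_act (\<Sum>a\<in>S. Polynomial.monom 1 (nat a)) (h \<circ> ext) u =
      shift_act (\<Sum>a\<in>S. Polynomial.monom 1 (nat a)) h (ext u)"
    by (simp add: act)
qed

text \<open>
  Modulo \<open>p\<close>, the \<open>p\<close>-th power of the adjacency operator is the adjacency operator of the
  connection set \<open>p S\<close>, whose entries on indicator functions are 0 or 1 and hence are determined
  by their residues.
\<close>

lemma preserves_dilate_prime:
  assumes S: "S \<subseteq> residues_mod n" and pres: "preserves n \<phi> S" and p: "prime p" "coprime p n"
  shows "preserves n \<phi> (dilate n (int p) S)"
  unfolding preserves_def
proof (intro ballI)
  fix u v assume u: "u \<in> residues_mod n" and v: "v \<in> residues_mod n"
  let ?F = "\<Sum>a\<in>S. Polynomial.monom (1 :: int) (nat a)"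
  have fin: "finite S" using S finite_subset by blast
  define G where "G = (\<Sum>a\<in>S. Polynomial.monom (1 :: int) (p * nat a))"
  have "of_nat p dvd ?F ^ p - (\<Sum>a\<in>S. Polynomial.monom 1 (nat a) ^ p)"
    by (rule prime_dvd_power_sum_diff[OF p(1)])
  moreover have "(\<Sum>a\<in>S. Polynomial.monom 1 (nat a) ^ p) = G"
    by (simp add: monom_power G_def mult.commute)
  ultimately obtain Q where Q: "?F ^ p - G = of_nat p * Q" by (auto simp: dvd_def)
  then have Q': "?F ^ p = G + Polynomial.smult (int p) Q"
    by (simp add: algebra_simps of_nat_poly)
  \<comment> \<open>Evaluating the commutation relation at this indicator function reads off single
    entries of the adjacency operator.\<close>
  define h where "h = (\<lambda>z. if [z = \<phi> v] (mod int n) then 1 else (0 :: int))"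
  have h: "periodic n h"
    by (simp add: periodic_def h_def Cong.cong_def)
  have "shift_act (?F ^ p) (h \<circ> ext) u = shift_act (?F ^ p) h (ext u)"
    using commutes_power[OF commutes_connection_poly[OF S pres]] h by (simp add: commutes_def)
  \<comment> \<open>Modulo \<open>p\<close> the contribution of \<open>Q\<close> vanishes, which
    leaves the relation for \<open>G\<close> alone.\<close>
  then have "[shift_act G (h \<circ> ext) u = shift_act G h (ext u)] (mod int p)"
    unfolding Q' shift_act_add shift_act_smult
    by (metis cong_add_lcancel Cong.cong_def mod_mult_self2)
  \<comment> \<open>Since \<open>p\<close> is invertible modulo \<open>n\<close>, at most one
    \<open>a\<close> in \<open>S\<close> contributes.\<close>
  moreover have count: "shift_act G g w = (if (w - x) mod int n \<in> dilate n (int p) S then 1 else 0)"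
    if g: "\<And>z. g z = (if [z = x] (mod int n) then 1 else 0)" for g w x
  proof -
    have "shift_act G g w = (\<Sum>a\<in>S. g (w - int p * a))"
      unfolding G_def shift_act_sum shift_act_monom using S by (intro sum.cong) auto
    also have "\<dots> = int (card {a \<in> S. [int p * a = w - x] (mod int n)})"
    proof -
      have eq: "[w - int p * a = x] (mod int n) \<longleftrightarrow> [int p * a = w - x] (mod int n)" for a
        by (auto simp: cong_iff_dvd_diff dvd_diff_commute algebra_simps)
      show ?thesis using fin by (simp add: g eq sum.If_cases Int_def)
    qed
    also have "card {a \<in> S. [int p * a = w - x] (mod int n)} =
        (if (w - x) mod int n \<in> dilate n (int p) S then 1 else 0)"
    proof (cases "(w - x) mod int n \<in> dilate n (int p) S")
      case True
      then obtain a where a: "a \<in> S" "(w - x) mod int n = (int p * a) mod int n"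
        by (auto simp: dilate_def)
      have "{a \<in> S. [int p * a = w - x] (mod int n)} = {a}"
      proof safe
        fix b assume b: "b \<in> S" "[int p * b = w - x] (mod int n)"
        then have "[int p * b = int p * a] (mod int n)" using a by (simp add: Cong.cong_def)
        then have "[b = a] (mod int n)" using p(2) by (simp add: cong_mult_lcancel)
        then show "b = a" using S a(1) b(1) by (auto simp: Cong.cong_def subset_iff)
      qed (use a in \<open>auto simp: Cong.cong_def\<close>)
      then show ?thesis using True by simp
    next
      case False
      have "{a \<in> S. [int p * a = w - x] (mod int n)} = {}"
      proof (intro equals0I)
        fix a assume "a \<in> {a \<in> S. [int p * a = w - x] (mod int n)}"
        then have "a \<in> S" "(w - x) mod int n = (int p * a) mod int n" by (simp_all add: Cong.cong_def)
        then show False using False unfolding dilate_def by blast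
      qed
      then show ?thesis using False by (simp only: card.empty if_False)
    qed
    finally show ?thesis by simp
  qed
  have v_eq: "ext v = \<phi> v" and u_eq: "ext u = \<phi> u"
    using u v by (auto simp: ext_def)
  have "(h \<circ> ext) z = (if [z = v] (mod int n) then 1 else 0)" for z
    using ext_in[of z] ext_in[of v] ext_eq_iff[of z v] by (auto simp: h_def v_eq Cong.cong_def)
  from count[OF this] have "shift_act G (h \<circ> ext) u = (if (u - v) mod int n \<in> dilate n (int p) S then 1 else 0)" .
  moreover have "shift_act G h (\<phi> u) = (if (\<phi> u - \<phi> v) mod int n \<in> dilate n (int p) S then 1 else 0)"
    by (rule count) (simp add: h_def)
  ultimately show "(\<phi> u - \<phi> v) mod int n \<in> dilate n (int p) S \<longleftrightarrow> (u - v) mod int n \<in> dilate n (int p) S"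
    using prime_gt_1_nat[OF p(1)] by (auto simp: u_eq Cong.cong_def split: if_splits)
qed

lemma dilate_subset: "dilate n m S \<subseteq> residues_mod n"
  using n_pos by (auto simp: dilate_def)

lemma dilate_dilate: "dilate n a (dilate n b S) = dilate n (a * b) S"
  by (simp add: dilate_def image_image mod_mult_right_eq mult.assoc)

text \<open>Dilations compose multiplicatively, so the prime factors of \<open>m\<close> can be
  treated one at a time.\<close>

lemma preserves_dilate:
  fixes m :: nat
  assumes S: "S \<subseteq> residues_mod n" and pres: "preserves n \<phi> S" and "coprime m n" "m > 0"
  shows "preserves n \<phi> (dilate n (int m) S)"
  using assms(3,4)
proof (induction m rule: prime_divisors_induct)
  case (unit x)
  have "(\<lambda>a. a mod int n) ` S = (\<lambda>a. a) ` S"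
    using S by (intro image_cong) auto
  then show ?case using unit pres by (simp add: dilate_def)
next
  case (factor p x)
  then have "preserves n \<phi> (dilate n (int p) (dilate n (int x) S))"
    by (intro preserves_dilate_prime dilate_subset factor.IH) auto
  then show ?case by (simp add: dilate_dilate)
qed simp

text \<open>Dilating \<open>S\<close> by an inverse \<open>l\<close> of \<open>m\<close> amounts to
  testing \<open>m * x\<close> for membership in \<open>S\<close>.\<close>

lemma preserves_unit_multiple:
  fixes m :: int
  assumes S: "S \<subseteq> residues_mod n" and pres: "preserves n \<phi> S" and m: "coprime m (int n)"
    and uv: "u \<in> residues_mod n" "v \<in> residues_mod n"
  shows "(m * (\<phi> u - \<phi> v)) mod int n \<in> S \<longleftrightarrow> (m * (u - v)) mod int n \<in> S"
proof -
  obtain k where k: "[m * k = 1] (mod int n)"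
    using m cong_solve_coprime_int by blast
  \<comment> \<open>Adding \<open>n\<close> makes \<open>l\<close> positive, as
    \<open>preserves_dilate\<close> demands, even if the residue of \<open>k\<close> is 0.\<close>
  define l where "l = nat (k mod int n) + n"
  have l: "int l = k mod int n + int n" using n_pos by (simp add: l_def)
  have ml: "[m * int l = 1] (mod int n)"
    using k cong_mult[OF cong_refl[of m], of "int l" k] cong_trans by (auto simp: l Cong.cong_def)
  then have cop: "coprime l n"
    using coprime_iff_invertible_int[of "int l" "int n"] by (auto simp: mult.commute)
  have mem: "x mod int n \<in> dilate n (int l) S \<longleftrightarrow> (m * x) mod int n \<in> S" for x
  proof
    assume "x mod int n \<in> dilate n (int l) S"
    then obtain a where a: "a \<in> S" "[x = int l * a] (mod int n)" by (auto simp: dilate_def Cong.cong_def)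
    have "[m * x = m * (int l * a)] (mod int n)" by (intro cong_mult cong_refl a)
    also have "[m * (int l * a) = 1 * a] (mod int n)"
      using cong_mult[OF ml cong_refl[of a]] by (simp add: mult.assoc)
    finally show "(m * x) mod int n \<in> S" using a(1) S by (auto simp: Cong.cong_def subset_iff)
  next
    assume *: "(m * x) mod int n \<in> S"
    have "[int l * ((m * x) mod int n) = x] (mod int n)"
      using cong_mult[OF ml cong_refl[of x]] by (simp add: Cong.cong_def mod_mult_right_eq ac_simps)
    with * show "x mod int n \<in> dilate n (int l) S"
      by (force simp: dilate_def Cong.cong_def)
  qed
  have "l > 0" using n_pos by (simp add: l_def)
  from preserves_dilate[OF S pres cop this] uv show ?thesis
    by (simp add: preserves_def mem)
qed

end

section \<open>Counting connection sets\<close>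

text \<open>A repeated prime multiplies the totient by \<open>p\<close>, a new one by
  \<open>p - 1\<close>, and \<open>p \<le> (p - 1)\<^sup>2\<close> for \<open>p \<ge> 3\<close>.
  Only the first factor 2 loses anything, which costs the constant 2.\<close>

lemma totient_square_ge: "n \<le> (if even n then 2 else 1) * totient n ^ 2"
proof (induction n rule: prime_divisors_induct)
  case (factor p x)
  have p: "p \<ge> 2" using factor.hyps prime_ge_2_nat by blast
  show ?case
  proof (cases "p dvd x")
    case True
    then have "gcd p x = p" by (simp add: gcd_nat.absorb1)
    then have "totient (p * x) * totient p = p * totient x * totient p"
      using totient_gcd[of p x] by (simp add: ac_simps)
    then have "totient (p * x) = p * totient x"
      using p by simp
    moreover have "even (p * x) \<longleftrightarrow> even x"
      using True by (metis dvd_mult dvd_trans even_mult_iff)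
    moreover have "p * x \<le> p\<^sup>2 * ((if even x then 2 else 1) * totient x ^ 2)"
      using factor.IH p by (intro mult_mono) (auto simp: power2_eq_square)
    ultimately show ?thesis by (simp add: power_mult_distrib ac_simps split: if_splits)
  next
    case False
    then have "coprime p x" using factor.hyps prime_imp_coprime_nat by blast
    then have tot: "totient (p * x) = (p - 1) * totient x"
      by (simp add: totient_mult_coprime totient_prime[OF factor.hyps])
    show ?thesis
    proof (cases "p = 2")
      case True
      then show ?thesis using False factor.IH tot by simp
    next
      case odd: False
      then have "p \<ge> 3" using p by simp
      then obtain q where q: "p = q + 3" using le_Suc_ex by (metis add.commute)
      have "p \<le> (p - 1)\<^sup>2" unfolding q by (simp add: power2_eq_square)
      moreover have "even (p * x) \<longleftrightarrow> even x"
        using \<open>p \<ge> 3\<close> factor.hyps prime_odd_nat[of p] by auto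
      moreover have "p * x \<le> (p - 1)\<^sup>2 * ((if even x then 2 else 1) * totient x ^ 2)"
        using factor.IH calculation(1) by (intro mult_mono) auto
      ultimately show ?thesis by (simp add: tot power_mult_distrib ac_simps split: if_splits)
    qed
  qed
qed auto

text \<open>Greedy choice: each chosen \<open>z\<close> removes at most \<open>k\<close> elements,
  namely those of \<open>N z\<close>, from the rest.\<close>

lemma exists_large_independent_subset:
  assumes "finite V" "\<And>z w. w \<in> N z \<Longrightarrow> z \<in> N w" "\<And>z. z \<in> N z"
    "\<And>z. finite (N z \<inter> V)" "\<And>z. card (N z \<inter> V) \<le> k"
  shows "\<exists>T\<subseteq>V. (\<forall>z\<in>T. \<forall>w\<in>T. w \<in> N z \<longrightarrow> w = z) \<and> card V \<le> k * card T"
  using assms(1,4,5)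
proof (induction "card V" arbitrary: V rule: less_induct)
  case less
  show ?case
  proof (cases "V = {}")
    case False
    then obtain z where z: "z \<in> V" by blast
    let ?W = "V - N z"
    have "?W \<subset> V" using z assms(3) by blast
    then have "card ?W < card V" using less.prems(1) psubset_card_mono by blast
    moreover have "card (N x \<inter> ?W) \<le> k" for x
      using less.prems by (meson Diff_subset Int_mono card_mono le_trans order_refl)
    ultimately obtain T where T: "T \<subseteq> ?W" "\<forall>z\<in>T. \<forall>w\<in>T. w \<in> N z \<longrightarrow> w = z" "card ?W \<le> k * card T"
      using less.hyps[of ?W] less.prems(1) by auto
    have "z \<notin> T" using T(1) assms(3) by blast
    have "finite T" using T(1) less.prems(1) finite_subset by blast
    have "card V = card ?W + card (N z \<inter> V)"
      using less.prems(1) by (subst card_Un_disjoint[symmetric]) (auto intro: arg_cong[where f = card])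
    then have "card V \<le> k * card (insert z T)"
      using T(3) less.prems(3)[of z] \<open>z \<notin> T\<close> \<open>finite T\<close> by simp
    moreover have "\<forall>x\<in>insert z T. \<forall>w\<in>insert z T. w \<in> N x \<longrightarrow> w = x"
      using T(1,2) assms(2) by blast
    moreover have "insert z T \<subseteq> V" using z T(1) by blast
    ultimately show ?thesis by blast
  qed auto
qed

section \<open>Connection sets under symmetric difference\<close>

definition connection_sets :: "nat \<Rightarrow> int set set"
  where "connection_sets n = {S. S \<subseteq> residues_mod n - {0} \<and> (\<lambda>s. (- s) mod int n) ` S = S}"

lemma ACG_eq: "ACG n = circulant_digraph n ` connection_sets n"
  by (auto simp: ACG_def connection_sets_def)

lemma connection_sets_subset: "connection_sets n \<subseteq> Pow (residues_mod n - {0})"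
  by (auto simp: connection_sets_def)

lemma finite_connection_sets: "finite (connection_sets n)"
  by (rule finite_subset[OF connection_sets_subset]) simp

lemma card_circulant_image:
  "A \<subseteq> connection_sets n \<Longrightarrow> card (circulant_digraph n ` A) = card A"
  using connection_sets_subset[of n]
  by (intro card_image inj_on_subset[OF inj_on_circulant_digraph]) simp

lemma neg_mod_neg: "x \<in> residues_mod n \<Longrightarrow> (- ((- x) mod int n)) mod int n = x"
  by (simp add: mod_minus_eq)

text \<open>In this pointwise form, closure under symmetric difference is immediate.\<close>

lemma connection_sets_iff:
  "S \<in> connection_sets n \<longleftrightarrow> S \<subseteq> residues_mod n - {0} \<and> (\<forall>s\<in>residues_mod n. (- s) mod int n \<in> S \<longleftrightarrow> s \<in> S)"
proof
  assume S: "S \<in> connection_sets n"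
  then have sub: "S \<subseteq> residues_mod n - {0}" and im: "(\<lambda>s. (- s) mod int n) ` S = S"
    by (auto simp: connection_sets_def)
  have "(- s) mod int n \<in> S" if "s \<in> S" for s using im that by blast
  then have "(- s) mod int n \<in> S \<longleftrightarrow> s \<in> S" if "s \<in> residues_mod n" for s
    using neg_mod_neg[OF that] by metis
  with sub show "S \<subseteq> residues_mod n - {0} \<and> (\<forall>s\<in>residues_mod n. (- s) mod int n \<in> S \<longleftrightarrow> s \<in> S)"
    by blast
next
  assume S: "S \<subseteq> residues_mod n - {0} \<and> (\<forall>s\<in>residues_mod n. (- s) mod int n \<in> S \<longleftrightarrow> s \<in> S)"
  then have "(- s) mod int n \<in> S" if "s \<in> S" for s using that by blast
  moreover have "s = (- ((- s) mod int n)) mod int n" if "s \<in> S" for s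
    using neg_mod_neg[of s n] S that by (metis Diff_iff subsetD)
  ultimately have "(\<lambda>s. (- s) mod int n) ` S = S" by (metis (no_types, lifting) image_subset_iff image_iff subsetI subset_antisym)
  with S show "S \<in> connection_sets n" by (simp add: connection_sets_def)
qed

lemma connection_sets_sym_diff:
  "S \<in> connection_sets n \<Longrightarrow> T \<in> connection_sets n \<Longrightarrow> sym_diff S T \<in> connection_sets n"
  unfolding connection_sets_iff by blast

text \<open>The sets whose unit multiples cannot tell the difference \<open>y\<close> from 1. By
  \<open>preserves_unit_multiple\<close>, an automorphism that sends two vertices at difference 1 to
  vertices at difference \<open>y\<close> forces \<open>S\<close> into this family.\<close>

definition confusing_sets :: "nat \<Rightarrow> int \<Rightarrow> int set set"
  where "confusing_sets n y = {S \<in> connection_sets n.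
    \<forall>m. coprime m (int n) \<longrightarrow> (m mod int n \<in> S \<longleftrightarrow> (m * y) mod int n \<in> S)}"

lemma confusing_sets_sym_diff:
  "S \<in> confusing_sets n y \<Longrightarrow> T \<in> confusing_sets n y \<Longrightarrow> sym_diff S T \<in> confusing_sets n y"
  unfolding confusing_sets_def using connection_sets_sym_diff[of S n T] by blast

section \<open>Units and their inverse-closures\<close>

definition units_mod :: "nat \<Rightarrow> int set"
  where "units_mod n = {z \<in> residues_mod n. coprime z (int n)}"

lemma card_units_mod:
  assumes "n > 1"
  shows "card (units_mod n) = totient n"
proof -
  have "bij_betw int (totatives n) (units_mod n)"
  proof (rule bij_betwI[where g = nat])
    show "int \<in> totatives n \<rightarrow> units_mod n"
      using assms totatives_less by (auto simp: units_mod_def in_totatives_iff)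
    show "nat \<in> units_mod n \<rightarrow> totatives n"
    proof
      fix x assume "x \<in> units_mod n"
      then have x: "0 \<le> x" "x < int n" "coprime x (int n)" by (auto simp: units_mod_def)
      have "x \<noteq> 0" using x(3) assms by auto
      then show "nat x \<in> totatives n"
        using x by (auto simp: in_totatives_iff nat_le_iff coprime_int_iff[symmetric])
    qed
  qed (auto simp: units_mod_def)
  then show ?thesis using bij_betw_same_card[of int "totatives n" "units_mod n"] by (simp add: totient_def)
qed

definition neg_closure :: "nat \<Rightarrow> int set \<Rightarrow> int set"
  where "neg_closure n R = R \<union> (\<lambda>s. (- s) mod int n) ` R"

lemma neg_closure_in_connection_sets:
  assumes "n > 1" "R \<subseteq> units_mod n"
  shows "neg_closure n R \<in> connection_sets n"
proof -
  have R: "R \<subseteq> residues_mod n - {0}"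
    using assms by (auto simp: units_mod_def)
  have "(\<lambda>s. (- s) mod int n) ` (\<lambda>s. (- s) mod int n) ` R = (\<lambda>s. s) ` R"
    unfolding image_image by (intro image_cong) (use R neg_mod_neg in blast)+
  moreover have "\<not> int n dvd s" if "s \<in> R" for s
  proof -
    have "s \<in> residues_mod n - {0}" using R that by blast
    then show ?thesis using zdvd_imp_le[of "int n" s] by auto
  qed
  ultimately show ?thesis
    using R assms(1) unfolding connection_sets_def neg_closure_def by (auto simp: image_Un)
qed

lemma residue_eqI: "x \<in> residues_mod n \<Longrightarrow> y \<in> residues_mod n \<Longrightarrow> [x = y] (mod int n) \<Longrightarrow> x = y"
  by (simp add: Cong.cong_def)

text \<open>
  The confusing sets form a subgroup under symmetric difference. For a set \<open>T\<close> of units such that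
  no two distinct elements of \<open>T\<close> are related by \<open>N\<close>, distinct subsets of \<open>T\<close> have inverse-closures
  in distinct cosets of this subgroup.
\<close>

lemma card_confusing_sets:
  assumes n: "n > 2" and y: "y \<in> residues_mod n" "y \<noteq> 1" "y \<noteq> int n - 1"
  shows "\<exists>k. totient n \<le> 6 * k \<and> card (confusing_sets n y) * 2 ^ k \<le> card (connection_sets n)"
proof -
  \<comment> \<open>For a non-unit \<open>y\<close> the default 1 keeps \<open>c\<close> invertible;
    the argument for \<open>one_sided\<close> derives that \<open>y\<close> is a unit before it
    needs \<open>c = y\<close>.\<close>
  define c where "c = (if coprime y (int n) then y else 1)"
  have "coprime c (int n)" by (simp add: c_def)
  then obtain d where d: "[c * d = 1] (mod int n)"
    using cong_solve_coprime_int by blast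
  \<comment> \<open>The relation generated by equality and multiplication by \<open>c\<close>, up to
    sign. The last two alternatives make it symmetric.\<close>
  define N where "N z = {w. [w = z] (mod int n) \<or> [w = - z] (mod int n) \<or>
    [w = c * z] (mod int n) \<or> [w = - (c * z)] (mod int n) \<or>
    [z = c * w] (mod int n) \<or> [z = - (c * w)] (mod int n)}" for z
  have neg: "[a = - b] (mod int n) \<longleftrightarrow> [b = - a] (mod int n)" for a b
    by (metis cong_minus_minus_iff cong_sym_eq minus_minus)
  have N_card: "card (N z \<inter> units_mod n) \<le> 6" for z
  proof -
    have dw: "[w = d * a] (mod int n)" if "[a = c * w] (mod int n)" for a w
    proof -
      have "[d * a = d * (c * w)] (mod int n)" by (intro cong_mult cong_refl that)
      also have "d * (c * w) = (c * d) * w" by (simp add: ac_simps)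
      also have "[c * d * w = 1 * w] (mod int n)" by (intro cong_mult cong_refl d)
      finally show ?thesis by (simp add: cong_sym_eq)
    qed
    \<comment> \<open>Solving each alternative for \<open>w\<close>, with \<open>d\<close> inverse
      to \<open>c\<close>, leaves these six residues.\<close>
    let ?L = "[z, - z, c * z, - (c * z), d * z, d * (- z)]"
    have "N z \<inter> units_mod n \<subseteq> (\<lambda>a. a mod int n) ` set ?L"
    proof
      fix w assume w: "w \<in> N z \<inter> units_mod n"
      then have "w = w mod int n" by (simp add: units_mod_def)
      moreover have "\<exists>a\<in>set ?L. [w = a] (mod int n)"
        using w dw[of z w] dw[of "- z" w] neg[of z "c * w"] cong_sym_eq[of "- z" "c * w"]
        unfolding N_def by auto
      ultimately show "w \<in> (\<lambda>a. a mod int n) ` set ?L"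
        unfolding Cong.cong_def by (metis image_eqI)
    qed
    then have "card (N z \<inter> units_mod n) \<le> card ((\<lambda>a. a mod int n) ` set ?L)"
      by (intro card_mono) auto
    also have "\<dots> \<le> card (set ?L)" by (rule card_image_le) simp
    also have "\<dots> \<le> length ?L" by (rule card_length)
    finally show ?thesis by simp
  qed
  have fin: "finite (units_mod n)"
    by (rule finite_subset[of _ "residues_mod n"]) (auto simp: units_mod_def)
  have "\<exists>T\<subseteq>units_mod n. (\<forall>z\<in>T. \<forall>w\<in>T. w \<in> N z \<longrightarrow> w = z) \<and> card (units_mod n) \<le> 6 * card T"
    by (rule exists_large_independent_subset[OF fin _ _ _ N_card])
       (use fin neg in \<open>auto simp: N_def cong_sym_eq\<close>)
  then obtain T where T: "T \<subseteq> units_mod n" "\<And>z w. z \<in> T \<Longrightarrow> w \<in> T \<Longrightarrow> w \<in> N z \<Longrightarrow> w = z"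
      "card (units_mod n) \<le> 6 * card T"
    by blast
  let ?B = "confusing_sets n y"
  \<comment> \<open>If \<open>z\<close> lay only in \<open>R\<close>, both \<open>z\<close> and
    \<open>z * y\<close> would lie in the symmetric difference. Then \<open>z * y\<close> would be
    \<open>w\<close> or \<open>- w\<close> for some \<open>w\<close> in \<open>T\<close>;
    independence gives \<open>w = z\<close>, so \<open>y\<close> would be 1 or -1.\<close>
  have one_sided: "z \<in> R'"
    if R: "R \<subseteq> T" "R' \<subseteq> T" and D: "sym_diff (neg_closure n R) (neg_closure n R') \<in> ?B" and z: "z \<in> R"
    for R R' z
  proof (rule ccontr)
    assume z': "z \<notin> R'"
    have zT: "z \<in> T" and zu: "z \<in> residues_mod n" "coprime z (int n)"
      using z R T(1) by (auto simp: units_mod_def)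
    have "z \<notin> neg_closure n R'"
    proof
      assume "z \<in> neg_closure n R'"
      then obtain w where w: "w \<in> R'" "z = (- w) mod int n"
        using z' by (auto simp: neg_closure_def)
      then have "[z = - w] (mod int n)" by (simp add: Cong.cong_def)
      then have "w \<in> N z" by (simp add: N_def neg)
      then show False using T(2)[OF zT] w(1) R(2) z' by blast
    qed
    moreover have "z \<in> neg_closure n R" using z by (simp add: neg_closure_def)
    ultimately have "z mod int n \<in> sym_diff (neg_closure n R) (neg_closure n R')"
      using zu(1) by simp
    with D zu(2) have "(z * y) mod int n \<in> sym_diff (neg_closure n R) (neg_closure n R')"
      unfolding confusing_sets_def by blast
    then obtain w where w: "w \<in> T" "(z * y) mod int n = w \<or> (z * y) mod int n = (- w) mod int n"
      using R unfolding neg_closure_def by blast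
    then have wu: "w \<in> residues_mod n" "coprime w (int n)" using T(1) by (auto simp: units_mod_def)
    have zy: "[z * y = w] (mod int n) \<or> [z * y = - w] (mod int n)"
      using w(2) wu(1) by (auto simp: Cong.cong_def)
    then have "coprime (z * y) (int n)"
      using wu(2) by (metis cong_imp_coprime cong_sym coprime_minus_left_iff)
    then have c: "c = y" by (simp add: c_def)
    have "[w = y * z] (mod int n) \<or> [w = - (y * z)] (mod int n)"
      using zy cong_sym[of "z * y" w] neg[of "z * y" w] by (auto simp: mult.commute)
    then have "w \<in> N z" unfolding N_def c by blast
    then have "w = z" using T(2)[OF zT w(1)] by blast
    then have "[z * y = z * 1] (mod int n) \<or> [z * y = z * (- 1)] (mod int n)"
      using zy by simp
    then have "[y = 1] (mod int n) \<or> [y = - 1] (mod int n)"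
      using zu(2) by (simp only: cong_mult_lcancel)
    moreover have "[int n - 1 = - 1] (mod int n)" by (simp add: cong_iff_dvd_diff)
    ultimately have "[y = 1] (mod int n) \<or> [y = int n - 1] (mod int n)"
      using cong_trans cong_sym by blast
    then show False using y n residue_eqI[of y n 1] residue_eqI[of y n "int n - 1"] by auto
  qed
  have separated: "R = R'"
    if "R \<subseteq> T" "R' \<subseteq> T" "sym_diff (neg_closure n R) (neg_closure n R') \<in> ?B" for R R'
    using one_sided[of R R'] one_sided[of R' R] that by (auto simp: Un_commute)
  have fin_B: "?B \<subseteq> connection_sets n" by (auto simp: confusing_sets_def)
  have "inj_on (\<lambda>(S, R). sym_diff S (neg_closure n R)) (?B \<times> Pow T)"
  proof (rule inj_onI, clarify)
    fix S R S' R'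
    assume S: "S \<in> ?B" "S' \<in> ?B" and R: "R \<subseteq> T" "R' \<subseteq> T"
      and eq: "sym_diff S (neg_closure n R) = sym_diff S' (neg_closure n R')"
    \<comment> \<open>Equal images place the two closures in the same coset of the confusing
      sets.\<close>
    have "sym_diff (neg_closure n R) (neg_closure n R') = sym_diff S S'" using eq by blast
    then have "R = R'" using separated[OF R] confusing_sets_sym_diff[OF S] by simp
    with eq show "S = S' \<and> R = R'" by blast
  qed
  moreover have "(\<lambda>(S, R). sym_diff S (neg_closure n R)) ` (?B \<times> Pow T) \<subseteq> connection_sets n"
  proof clarify
    fix S R assume "S \<in> ?B" "R \<subseteq> T"
    then show "sym_diff S (neg_closure n R) \<in> connection_sets n"
      using n T(1) fin_B by (intro connection_sets_sym_diff neg_closure_in_connection_sets) auto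
  qed
  ultimately have "card (?B \<times> Pow T) \<le> card (connection_sets n)"
    by (rule card_inj_on_le) (rule finite_connection_sets)
  moreover have "finite T" using T(1) fin finite_subset by blast
  ultimately have "card ?B * 2 ^ card T \<le> card (connection_sets n)"
    by (simp add: card_cartesian_product card_Pow)
  then show ?thesis using T(3) n by (auto simp: card_units_mod)
qed

section \<open>Automorphisms\<close>

lemma pverts_circulant_digraph: "pverts (circulant_digraph n S) = residues_mod n"
  by (simp add: circulant_digraph_def)

lemma parcs_circulant_digraph_iff:
  "(u, v) \<in> parcs (circulant_digraph n S) \<longleftrightarrow>
    u \<in> residues_mod n \<and> v \<in> residues_mod n \<and> (u - v) mod int n \<in> S"
  by (simp add: circulant_digraph_def)

lemma graph_Aut_preserves:
  assumes "f \<in> graph_Aut (circulant_digraph n S)"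
  shows "preserves n f S" "f \<in> Bij (residues_mod n)"
proof -
  show B: "f \<in> Bij (residues_mod n)" using assms by (simp add: graph_Aut_def circulant_digraph_def)
  show "preserves n f S"
    unfolding preserves_def
  proof (intro ballI)
    fix u v assume uv: "u \<in> residues_mod n" "v \<in> residues_mod n"
    have "f u \<in> residues_mod n" "f v \<in> residues_mod n"
      using Bij_imp_funcset[OF B] uv by (auto simp del: atLeastLessThan_iff)
    moreover have "(f u, f v) \<in> parcs (circulant_digraph n S) \<longleftrightarrow> (u, v) \<in> parcs (circulant_digraph n S)"
      using assms uv unfolding graph_Aut_def pverts_circulant_digraph by blast
    ultimately show "(f u - f v) mod int n \<in> S \<longleftrightarrow> (u - v) mod int n \<in> S"
      using uv by (simp only: parcs_circulant_digraph_iff simp_thms)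
  qed
qed

lemma rot_in_graph_Aut: "rot n \<in> graph_Aut (circulant_digraph n S)"
proof -
  have "(rot n u - rot n v) mod int n = (u - v) mod int n"
    if "u \<in> residues_mod n" "v \<in> residues_mod n" for u v
    using that by (simp add: rot_def mod_diff_eq)
  moreover have "rot n u \<in> residues_mod n" if "u \<in> residues_mod n" for u
    using Bij_imp_funcset[OF rot_refl_in_Bij(1)] that by blast
  ultimately show ?thesis
    using rot_refl_in_Bij(1)[of n] by (simp add: graph_Aut_def circulant_digraph_def)
qed

lemma refl_map_in_graph_Aut:
  assumes "S \<in> connection_sets n"
  shows "refl_map n \<in> graph_Aut (circulant_digraph n S)"
proof -
  have "(refl_map n u - refl_map n v) mod int n \<in> S \<longleftrightarrow> (u - v) mod int n \<in> S"
    if "u \<in> residues_mod n" "v \<in> residues_mod n" for u v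
  proof -
    have "(refl_map n u - refl_map n v) mod int n = (- ((u - v) mod int n)) mod int n"
      using that by (simp add: refl_map_def mod_diff_eq mod_minus_eq)
    moreover have "(u - v) mod int n \<in> residues_mod n" using that by simp
    ultimately show ?thesis using assms unfolding connection_sets_iff by metis
  qed
  moreover have "refl_map n u \<in> residues_mod n" if "u \<in> residues_mod n" for u
    using Bij_imp_funcset[OF rot_refl_in_Bij(2)] that by blast
  ultimately show ?thesis
    using rot_refl_in_Bij(2)[of n] by (simp add: graph_Aut_def circulant_digraph_def)
qed

section \<open>The dihedral group in affine form\<close>

abbreviation dihedral :: "nat \<Rightarrow> (int \<Rightarrow> int) set"
  where "dihedral n \<equiv> generate (BijGroup (residues_mod n)) {rot n, refl_map n}"

lemma dihedral_subset_graph_Aut: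
  assumes "S \<in> connection_sets n"
  shows "dihedral n \<subseteq> graph_Aut (circulant_digraph n S)"
proof -
  show ?thesis
    using pverts_circulant_digraph[of n S] subgroup_graph_Aut[of "circulant_digraph n S"] rot_in_graph_Aut refl_map_in_graph_Aut[OF assms]
    by (intro group.generate_subgroup_incl[OF group_BijGroup]) auto
qed

lemma dihedral_subset_Bij: "dihedral n \<subseteq> Bij (residues_mod n)"
  using group.generate_incl[OF group_BijGroup, of "{rot n, refl_map n}" "residues_mod n"] rot_refl_in_Bij
  by (simp add: BijGroup_def)

lemma dihedral_compose:
  assumes "f \<in> dihedral n" "g \<in> dihedral n"
  shows "compose (residues_mod n) f g \<in> dihedral n"
proof -
  have "f \<in> Bij (residues_mod n)" "g \<in> Bij (residues_mod n)"
    using assms dihedral_subset_Bij by blast+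
  then have "f \<otimes>\<^bsub>BijGroup (residues_mod n)\<^esub> g = compose (residues_mod n) f g"
    by (simp add: BijGroup_def)
  with generate.eng[OF assms] show ?thesis by simp
qed

lemma translation_in_dihedral:
  "(\<lambda>i\<in>residues_mod n. (i + int k) mod int n) \<in> dihedral n"
proof (induction k)
  case 0
  have "(\<lambda>i\<in>residues_mod n. (i + int 0) mod int n) = \<one>\<^bsub>BijGroup (residues_mod n)\<^esub>"
    by (auto simp: BijGroup_def fun_eq_iff restrict_def)
  then show ?case by (simp add: generate.one)
next
  case (Suc k)
  have eq: "compose (residues_mod n) (rot n) (\<lambda>i\<in>residues_mod n. (i + int k) mod int n) =
      (\<lambda>i\<in>residues_mod n. (i + int (Suc k)) mod int n)"
    by (auto simp: compose_def rot_def fun_eq_iff restrict_def mod_add_left_eq mod_add_right_eq ac_simps)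
  show ?case
    unfolding eq[symmetric] by (rule dihedral_compose[OF generate.incl Suc.IH]) simp
qed

text \<open>For \<open>e = 1\<close> the map is the translation by \<open>f 0\<close>; otherwise it
  is \<open>refl_map n\<close> followed by that translation.\<close>

lemma affine_in_dihedral:
  assumes f: "f \<in> Bij (residues_mod n)" and n: "n > 0" and e: "e = 1 \<or> e = - 1"
    and f_eq: "\<And>i. i \<in> residues_mod n \<Longrightarrow> f i = (f 0 + e * i) mod int n"
  shows "f \<in> dihedral n"
proof -
  have f0: "f 0 \<in> residues_mod n" using Bij_imp_funcset[OF f] n by auto
  let ?t = "\<lambda>i\<in>residues_mod n. (i + int (nat (f 0))) mod int n"
  \<comment> \<open>Equality of functions must also be checked off the residues, where both sides
    are \<open>undefined\<close>.\<close>
  have ext: "f i = undefined" if "i \<notin> residues_mod n" for i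
    using Bij_imp_extensional[OF f] that by (rule extensional_arb)
  show ?thesis
  proof (cases "e = 1")
    case True
    have "f i = ?t i" for i
      using f_eq[of i] ext[of i] f0 True by (cases "i \<in> residues_mod n") (auto simp: ac_simps)
    then have "f = ?t" by blast
    then show ?thesis using translation_in_dihedral by metis
  next
    case False
    have "f i = compose (residues_mod n) ?t (refl_map n) i" for i
    proof (cases "i \<in> residues_mod n")
      case True
      then have "compose (residues_mod n) ?t (refl_map n) i = ((- i) mod int n + f 0) mod int n"
        using n f0 by (simp add: compose_def refl_map_def)
      also have "\<dots> = (f 0 + e * i) mod int n" using False e by (auto simp: mod_simps algebra_simps)
      finally show ?thesis using f_eq[OF True] by simp
    next
      case False
      show ?thesis
        using ext[OF False] extensional_arb[OF compose_extensional False] by metis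
    qed
    then have "f = compose (residues_mod n) ?t (refl_map n)" by blast
    moreover have "compose (residues_mod n) ?t (refl_map n) \<in> dihedral n"
      by (rule dihedral_compose[OF translation_in_dihedral generate.incl]) simp
    ultimately show ?thesis by (rule ssubst[where P = "\<lambda>g. g \<in> dihedral n"])
  qed
qed

text \<open>The residue \<open>int n - 1\<close> stands for -1. The two exceptions are unavoidable,
  because every inverse-closed set confuses 1 with 1 and with -1.\<close>

definition separating :: "nat \<Rightarrow> int set \<Rightarrow> bool"
  where "separating n S \<longleftrightarrow> (\<forall>y\<in>residues_mod n. S \<in> confusing_sets n y \<longrightarrow> y = 1 \<or> y = int n - 1)"

text \<open>Separation forces consecutive vertices to have images differing by 1 or -1, and
  injectivity keeps the sign constant, so \<open>f\<close> is affine.\<close>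

lemma automorphism_of_separating_in_dihedral:
  assumes n: "n > 2" and S: "S \<in> connection_sets n" and sep: "separating n S"
    and f: "f \<in> graph_Aut (circulant_digraph n S)"
  shows "f \<in> dihedral n"
proof -
  note fB = graph_Aut_preserves(2)[OF f] and pres = graph_Aut_preserves(1)[OF f]
  interpret residue_perm n f
    using n fB by unfold_locales (auto simp: Bij_def)
  have SV: "S \<subseteq> residues_mod n" using S by (auto simp: connection_sets_def)
  have step: "[ext (u + 1) = ext u + 1] (mod int n) \<or> [ext (u + 1) = ext u - 1] (mod int n)" for u
  proof -
    let ?y = "(ext (u + 1) - ext u) mod int n"
    have "m mod int n \<in> S \<longleftrightarrow> (m * ?y) mod int n \<in> S" if m: "coprime m (int n)" for m
    proof -
      have "(m * ((u + 1) mod int n - u mod int n)) mod int n = (m * (u + 1 - u)) mod int n"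
        by (metis mod_diff_eq mod_mult_right_eq)
      then show ?thesis
        using preserves_unit_multiple[OF SV pres m mod_in mod_in, of "u + 1" u]
        by (simp add: ext_def mod_mult_right_eq)
    qed
    then have "S \<in> confusing_sets n ?y" using S by (simp add: confusing_sets_def)
    then have "?y = 1 \<or> ?y = int n - 1" using sep mod_in unfolding separating_def by blast
    moreover have "[ext (u + 1) - ext u = ?y] (mod int n)" by (simp add: Cong.cong_def)
    ultimately have "[ext (u + 1) - ext u = 1] (mod int n) \<or> [ext (u + 1) - ext u = int n - 1] (mod int n)"
      by metis
    then show ?thesis
    proof
      assume "[ext (u + 1) - ext u = 1] (mod int n)"
      then show ?thesis by (simp add: cong_iff_dvd_diff algebra_simps)
    next
      assume "[ext (u + 1) - ext u = int n - 1] (mod int n)"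
      \<comment> \<open>Adding \<open>int n\<close> back replaces the representative
        \<open>int n - 1\<close> by -1.\<close>
      then have "int n dvd (ext (u + 1) - ext u - (int n - 1)) + int n"
        by (intro dvd_add) (simp_all add: cong_iff_dvd_diff)
      then show ?thesis by (simp add: cong_iff_dvd_diff algebra_simps)
    qed
  qed
  obtain e where e: "e = 1 \<or> e = - 1" and e1: "[ext 1 = ext 0 + e] (mod int n)"
    using step[of 0] that[of 1] that[of "- 1"] by auto
  \<comment> \<open>The sign cannot change along the cycle, since that would give \<open>f (u + 2) = f u\<close>.\<close>
  have "[ext (int k) = ext 0 + e * int k] (mod int n) \<and>
      [ext (int k + 1) = ext 0 + e * (int k + 1)] (mod int n)" for k
  proof (induction k)
    case 0
    then show ?case using e1 by simp
  next
    case (Suc k)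
    let ?u = "int k + 1"
    have "[ext (?u + 1) = ext ?u + e] (mod int n)"
    proof (rule ccontr)
      assume "\<not> ?thesis"
      then have "[ext (?u + 1) = ext ?u - e] (mod int n)" using step[of ?u] e by auto
      also have "[ext ?u - e = ext 0 + e * ?u - e] (mod int n)"
        using Suc.IH by (intro cong_diff cong_refl) simp
      also have "ext 0 + e * ?u - e = ext 0 + e * int k" by (simp add: algebra_simps)
      also have "[ext 0 + e * int k = ext (int k)] (mod int n)"
        using Suc.IH cong_sym by blast
      finally have "ext (?u + 1) = ext (int k)" by (rule residue_eqI[OF ext_in ext_in])
      then have "int n dvd 2" by (simp add: ext_eq_iff cong_iff_dvd_diff)
      then show False using n zdvd_imp_le by fastforce
    qed
    also have "[ext ?u + e = (ext 0 + e * ?u) + e] (mod int n)"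
      using Suc.IH by (intro cong_add cong_refl) simp
    finally show ?case using Suc.IH by (simp add: algebra_simps)
  qed
  then have *: "[ext (int k) = ext 0 + e * int k] (mod int n)" for k by blast
  have "f i = (f 0 + e * i) mod int n" if i: "i \<in> residues_mod n" for i
  proof -
    have "ext i = f i" "ext 0 = f 0" using i by (simp_all add: ext_def)
    with *[of "nat i"] i have "[f i = f 0 + e * i] (mod int n)" by simp
    moreover have "f i \<in> residues_mod n" using ext_in[of i] \<open>ext i = f i\<close> by simp
    ultimately show ?thesis by (simp add: Cong.cong_def)
  qed
  with affine_in_dihedral[OF fB n_pos e] show ?thesis by blast
qed

lemma separating_imp_Small:
  assumes "n > 2" "S \<in> connection_sets n" "separating n S"
  shows "circulant_digraph n S \<in> Small n"
  unfolding Small_def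
  using assms automorphism_of_separating_in_dihedral[OF assms] dihedral_subset_graph_Aut[OF assms(2)]
  by (auto simp: ACG_eq)

section \<open>The limit\<close>

text \<open>Union bound over the differences other than 1 and -1. The exponent arises from
  \<open>k \<ge> totient n / 6\<close> and \<open>totient n \<ge> sqrt (n / 2)\<close>.\<close>

lemma card_not_separating:
  assumes n: "n > 2"
  shows "real (card {S \<in> connection_sets n. \<not> separating n S}) \<le>
    real n * 2 powr (- sqrt (n / 2) / 6) * card (connection_sets n)"
proof -
  let ?C = "real (card (connection_sets n))" and ?Y = "residues_mod n - {1, int n - 1}"
  have each: "card (confusing_sets n y) \<le> 2 powr (- sqrt (n / 2) / 6) * ?C" if y: "y \<in> ?Y" for y
  proof -
    obtain k where k: "totient n \<le> 6 * k" "card (confusing_sets n y) * 2 ^ k \<le> card (connection_sets n)"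
      using card_confusing_sets[OF n] y by blast
    have "n \<le> 2 * totient n ^ 2" using totient_square_ge[of n] by (auto split: if_splits)
    then have "real n \<le> real (2 * totient n ^ 2)" by (rule of_nat_mono)
    then have "sqrt (n / 2) \<le> totient n" by (intro real_le_lsqrt) auto
    then have "sqrt (n / 2) / 6 \<le> k" using k(1) by linarith
    then have "card (confusing_sets n y) * 2 powr (sqrt (n / 2) / 6) \<le> card (confusing_sets n y) * 2 powr k"
      by (intro mult_left_mono powr_mono) auto
    also have "\<dots> \<le> ?C"
      using of_nat_mono[OF k(2), where ?'a = real] by (simp add: powr_realpow)
    finally show ?thesis by (simp add: powr_minus field_simps)
  qed
  have "{S \<in> connection_sets n. \<not> separating n S} \<subseteq> (\<Union>y\<in>?Y. confusing_sets n y)"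
    by (auto simp: separating_def)
  moreover have "finite (\<Union>y\<in>?Y. confusing_sets n y)"
    by (rule finite_subset[OF _ finite_connection_sets[of n]]) (auto simp: confusing_sets_def)
  ultimately have "card {S \<in> connection_sets n. \<not> separating n S} \<le> card (\<Union>y\<in>?Y. confusing_sets n y)"
    by (intro card_mono)
  also have "\<dots> \<le> (\<Sum>y\<in>?Y. card (confusing_sets n y))"
    by (rule card_UN_le) simp
  finally have "real (card {S \<in> connection_sets n. \<not> separating n S}) \<le> real (\<Sum>y\<in>?Y. card (confusing_sets n y))"
    by (rule of_nat_mono)
  also have "\<dots> = (\<Sum>y\<in>?Y. real (card (confusing_sets n y)))" by simp
  also have "\<dots> \<le> (\<Sum>y\<in>?Y. 2 powr (- sqrt (n / 2) / 6) * ?C)"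
    by (intro sum_mono each)
  also have "\<dots> = real (card ?Y) * (2 powr (- sqrt (n / 2) / 6) * ?C)" by simp
  also have "\<dots> \<le> real n * (2 powr (- sqrt (n / 2) / 6) * ?C)"
  proof (intro mult_right_mono)
    have "card ?Y \<le> card (residues_mod n)" by (intro card_mono) auto
    then show "real (card ?Y) \<le> real n" by simp
  qed simp
  finally show ?thesis by (simp only: mult.assoc)
qed

text \<open>Every separating set gives a graph in \<open>Small n\<close>, and distinct sets give
  distinct graphs, so only the non-separating sets are lost.\<close>

lemma Small_fraction_ge:
  assumes n: "n > 2"
  shows "1 - real n * 2 powr (- sqrt (n / 2) / 6) \<le> real (card (Small n)) / real (card (ACG n))"
proof -
  let ?G = "{S \<in> connection_sets n. separating n S}" and ?B = "{S \<in> connection_sets n. \<not> separating n S}"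
  let ?C = "card (connection_sets n)"
  have "?C = card (?G \<union> ?B)" by (rule arg_cong[where f = card]) blast
  also have "\<dots> = card ?G + card ?B"
    using finite_connection_sets by (intro card_Un_disjoint) auto
  finally have C: "?C = card ?G + card ?B" .
  have "card ?G = card (circulant_digraph n ` ?G)" by (rule card_circulant_image[symmetric]) simp
  also have "\<dots> \<le> card (Small n)"
    using separating_imp_Small[OF n] finite_subset[OF _ finite_ACG, of "Small n"]
    by (intro card_mono) (auto simp: Small_def)
  finally have "real ?C - real (card ?B) \<le> card (Small n)" using C by linarith
  with card_not_separating[OF n] have "(1 - real n * 2 powr (- sqrt (n / 2) / 6)) * ?C \<le> card (Small n)"
    by (simp add: algebra_simps)
  moreover have "card (ACG n) = ?C" unfolding ACG_eq by (rule card_circulant_image) simp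
  moreover have "card (ACG n) > 0" using finite_ACG ACG_nonempty by (simp add: card_gt_0_iff)
  ultimately show ?thesis by (simp add: le_divide_eq)
qed

theorem theorem3p1:
  shows "(\<lambda>n. real (card (Small n)) / real (card (ACG n))) \<longlonglongrightarrow> 1"
proof (rule real_tendsto_sandwich)
  show "(\<lambda>n. 1 - real n * 2 powr (- sqrt (n / 2) / 6)) \<longlonglongrightarrow> 1"
    \<comment> \<open>The exponential decay in \<open>sqrt n\<close> outweighs the factor
      \<open>n\<close>.\<close>
    by real_asymp
  show "(\<lambda>_. 1 :: real) \<longlonglongrightarrow> 1" by simp
  show "\<forall>\<^sub>F n in sequentially. 1 - real n * 2 powr (- sqrt (n / 2) / 6) \<le> real (card (Small n)) / real (card (ACG n))"
    using eventually_gt_at_top[of 2] by eventually_elim (rule Small_fraction_ge)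
  have "card (Small n) \<le> card (ACG n)" for n
    by (rule card_mono[OF finite_ACG]) (auto simp: Small_def)
  then show "\<forall>\<^sub>F n in sequentially. real (card (Small n)) / real (card (ACG n)) \<le> 1"
    by (intro always_eventually allI divide_le_eq_1[THEN iffD2]) (auto simp: not_less)
qed

end
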